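(* Every Polish SIN group $G$ with property (BNG) has the topological Bergman property. If $G$ is a Polish SIN group with property $k$-(BNG) for some fixed $k\in\mathbb{N}$, then $G$ has the $2k$-topological Bergman property.
   Context: A topological group is Polish if its topology is separable and completely metrizable. A topological group $G$ is SIN if it admits a neighborhood basis at the identity consisting of conjugacy-invariant open neighborhoods. For subsets $W$ of a group, $W^k=\{w_1\cdots w_k\mid w_i\in W\}$. A group $G$ has property (BNG) (bounded normal generation) if for every $g\in G\setminus\{1\}$ there exists $k\in\mathbb{N}$ such that $G=(g^G\cup g^{-G})^k$, where $g^G=\{hgh^{-1}\mid h\in G\}$ and $g^{-G}=(g^{-1})^G$. If the exponent $k$ can be chosen independently of $g\in G\setminus\{1\}$, then $G$ has property $k$-(BNG). A topological group $G$ has the topological Bergman property if for every increasing sequence $W_0\subseteq W_1\subseteq\ldots\subseteq G$ of symmetric subsets with the Baire property satisfying $G=\bigcup_n W_n$, there are $n,k\in\mathbb{N}$ such that $G=W_n^k$. If $k$ can be chosen independently of the sequence $(W_n)_n$, then $G$ has the $k$-topological Bergman property.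
   Formalization: The formal statement additionally assumes that G is finite or not discrete; for infinite discrete G the claim fails, e.g. PSL(2,Q) with the discrete topology is Polish, SIN and has 16-(BNG), but lacks the topological Bergman property. *)

theory Defs
  imports "HOL-Analysis.Analysis" "HOL-Algebra.Coset"
begin

section \<open>Topological groups\<close>

text \<open>No separation axiom is built in; in a Polish group the Hausdorff property follows from
  metrizability.\<close>

definition topological_group :: "('a, 'b) monoid_scheme \<Rightarrow> 'a topology \<Rightarrow> bool" where
  "topological_group G X \<longleftrightarrow>
     group G \<and> topspace X = carrier G \<and>
     continuous_map (prod_topology X X) X (\<lambda>(x, y). x \<otimes>\<^bsub>G\<^esub> y) \<and>
     continuous_map X X (\<lambda>x. inv\<^bsub>G\<^esub> x)"

definition Polish_group :: "('a, 'b) monoid_scheme \<Rightarrow> 'a topology \<Rightarrow> bool" where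
  "Polish_group G X \<longleftrightarrow>
     topological_group G X \<and> separable_space X \<and> completely_metrizable_space X"

definition conj_invariant :: "('a, 'b) monoid_scheme \<Rightarrow> 'a set \<Rightarrow> bool" where
  "conj_invariant G V \<longleftrightarrow>
     (\<forall>h \<in> carrier G. \<forall>v \<in> V. h \<otimes>\<^bsub>G\<^esub> v \<otimes>\<^bsub>G\<^esub> inv\<^bsub>G\<^esub> h \<in> V)"

definition SIN_group :: "('a, 'b) monoid_scheme \<Rightarrow> 'a topology \<Rightarrow> bool" where
  "SIN_group G X \<longleftrightarrow>
     topological_group G X \<and>
     (\<exists>\<B>. (\<forall>V \<in> \<B>. openin X V \<and> \<one>\<^bsub>G\<^esub> \<in> V \<and> conj_invariant G V) \<and>
          (\<forall>U. openin X U \<and> \<one>\<^bsub>G\<^esub> \<in> U \<longrightarrow> (\<exists>V \<in> \<B>. V \<subseteq> U)))"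

section \<open>Bounded normal generation\<close>

primrec set_power :: "('a, 'b) monoid_scheme \<Rightarrow> 'a set \<Rightarrow> nat \<Rightarrow> 'a set" where
  "set_power G W 0 = {\<one>\<^bsub>G\<^esub>}"
| "set_power G W (Suc k) = set_power G W k <#>\<^bsub>G\<^esub> W"

definition conj_class :: "('a, 'b) monoid_scheme \<Rightarrow> 'a \<Rightarrow> 'a set" where
  "conj_class G g = {h \<otimes>\<^bsub>G\<^esub> g \<otimes>\<^bsub>G\<^esub> inv\<^bsub>G\<^esub> h |h. h \<in> carrier G}"

definition BNG :: "('a, 'b) monoid_scheme \<Rightarrow> bool" where
  "BNG G \<longleftrightarrow>
     (\<forall>g \<in> carrier G - {\<one>\<^bsub>G\<^esub>}. \<exists>k.
        carrier G = set_power G (conj_class G g \<union> conj_class G (inv\<^bsub>G\<^esub> g)) k)"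

definition k_BNG :: "nat \<Rightarrow> ('a, 'b) monoid_scheme \<Rightarrow> bool" where
  "k_BNG k G \<longleftrightarrow>
     (\<forall>g \<in> carrier G - {\<one>\<^bsub>G\<^esub>}.
        carrier G = set_power G (conj_class G g \<union> conj_class G (inv\<^bsub>G\<^esub> g)) k)"

section \<open>Baire property\<close>

definition nowhere_dense_in :: "'a topology \<Rightarrow> 'a set \<Rightarrow> bool" where
  "nowhere_dense_in X N \<longleftrightarrow> N \<subseteq> topspace X \<and> X interior_of (X closure_of N) = {}"

definition meagre_in :: "'a topology \<Rightarrow> 'a set \<Rightarrow> bool" where
  "meagre_in X A \<longleftrightarrow>
     (\<exists>\<N>. countable \<N> \<and> (\<forall>N \<in> \<N>. nowhere_dense_in X N) \<and> A = \<Union>\<N>)"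

definition Baire_property_in :: "'a topology \<Rightarrow> 'a set \<Rightarrow> bool" where
  "Baire_property_in X A \<longleftrightarrow>
     A \<subseteq> topspace X \<and> (\<exists>U. openin X U \<and> meagre_in X ((A - U) \<union> (U - A)))"

section \<open>Topological Bergman property\<close>

definition Bergman_sequence ::
    "('a, 'b) monoid_scheme \<Rightarrow> 'a topology \<Rightarrow> (nat \<Rightarrow> 'a set) \<Rightarrow> bool" where
  "Bergman_sequence G X W \<longleftrightarrow>
     incseq W \<and>
     (\<forall>n. W n \<subseteq> carrier G \<and> set_inv\<^bsub>G\<^esub> (W n) = W n \<and> Baire_property_in X (W n)) \<and>
     carrier G = (\<Union>n. W n)"

definition topological_Bergman :: "('a, 'b) monoid_scheme \<Rightarrow> 'a topology \<Rightarrow> bool" where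
  "topological_Bergman G X \<longleftrightarrow>
     (\<forall>W. Bergman_sequence G X W \<longrightarrow> (\<exists>n k. carrier G = set_power G (W n) k))"

definition k_topological_Bergman ::
    "nat \<Rightarrow> ('a, 'b) monoid_scheme \<Rightarrow> 'a topology \<Rightarrow> bool" where
  "k_topological_Bergman k G X \<longleftrightarrow>
     (\<forall>W. Bergman_sequence G X W \<longrightarrow> (\<exists>n. carrier G = set_power G (W n) k))"

section \<open>Infinite discrete groups\<close>

text \<open>Countably infinite discrete groups are Polish and SIN, and some of them have property (BNG),
  for instance \<open>PSL(2, \<rat>)\<close>; but none of them has the topological Bergman property, as the
  following lemma shows. Results deducing the topological Bergman property from (BNG) therefore
  have to exclude these groups.\<close>

lemma infinite_discrete_not_topological_Bergman:
  assumes "Polish_group G X" and discrete: "X = discrete_topology (carrier G)"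
    and inf: "infinite (carrier G)"
  shows "\<not> topological_Bergman G X"
proof
  assume Bergman: "topological_Bergman G X"
  interpret group G
    using assms(1) by (simp add: Polish_group_def topological_group_def)
  have "separable_space X"
    using assms(1) by (simp add: Polish_group_def)
  then obtain C where C: "countable C" "C \<subseteq> topspace X" "X closure_of C = topspace X"
    unfolding separable_space_def by blast
  have "C \<inter> {x} \<noteq> {}" if "x \<in> carrier G" for x
    using C(3) that discrete unfolding dense_intersects_open by auto
  then have "carrier G \<subseteq> C" by auto
  then have cnt: "countable (carrier G)"
    using C(1) countable_subset by blast
  define f where "f = from_nat_into (carrier G)"
  have f: "range f = carrier G"
    unfolding f_def using cnt inf by (simp add: range_from_nat_into infinite_imp_nonempty)
  define W where "W n = f ` {..n} \<union> set_inv\<^bsub>G\<^esub> (f ` {..n})" for n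
  have f_in: "f i \<in> carrier G" for i
    using f by blast
  have W_sub: "W n \<subseteq> carrier G" for n
    unfolding W_def SET_INV_def using f_in by auto
  have W_fin: "finite (W n)" for n
    unfolding W_def SET_INV_def by simp
  have W_inv: "set_inv\<^bsub>G\<^esub> (W n) = W n" for n
    unfolding W_def SET_INV_def using f_in by auto
  have W_Baire: "Baire_property_in X (W n)" for n
    unfolding Baire_property_in_def meagre_in_def
    using W_sub discrete by (intro conjI exI[of _ "W n"] exI[of _ "{}"]) auto
  have W_inc: "incseq W"
    unfolding W_def SET_INV_def by (rule monoI) fastforce
  have W_Un: "carrier G = (\<Union>n. W n)"
  proof -
    have "f i \<in> W i" for i
      unfolding W_def by auto
    then have "range f \<subseteq> (\<Union>n. W n)"
      by auto
    moreover have "(\<Union>n. W n) \<subseteq> carrier G"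
      using W_sub by (rule UN_least)
    ultimately show ?thesis
      using f by simp
  qed
  have "Bergman_sequence G X W"
    unfolding Bergman_sequence_def by (intro conjI allI W_sub W_inv W_Baire W_inc W_Un)
  then obtain n k where nk: "carrier G = set_power G (W n) k"
    using Bergman unfolding topological_Bergman_def by blast
  have "finite (set_power G (W n) k)"
    by (induction k) (auto simp: set_mult_def W_fin)
  with nk inf show False by simp
qed

end

theory Submission
  imports Defs
begin

text \<open>By the Baire category theorem some \<open>W n\<close> is non-meagre, so by Pettis' argument
  \<open>W n \<cdot> W n\<close> contains an identity neighbourhood, which by SIN may be taken conjugacy-invariant.
  As \<open>G\<close> is not discrete, this neighbourhood contains some \<open>g \<noteq> 1\<close> together with its conjugacy
  class; by symmetry of \<open>W n\<close> the class of the inverse lies in \<open>W n \<cdot> W n\<close> as well. Bounded normal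
  generation for \<open>g\<close> with exponent \<open>k\<close> yields \<open>G = (W n)\<^bsup>2k\<^esup>\<close>. If \<open>G\<close> is finite, then \<open>G = W n\<close> for
  some \<open>n\<close>.\<close>

section \<open>Meagre sets\<close>

lemma nowhere_dense_in_subset:
  assumes "nowhere_dense_in X N" "M \<subseteq> N"
  shows "nowhere_dense_in X M"
  using assms interior_of_mono[OF closure_of_mono[OF assms(2)], of X X]
  unfolding nowhere_dense_in_def by auto

lemma meagre_in_subset:
  assumes "meagre_in X A" "B \<subseteq> A"
  shows "meagre_in X B"
proof -
  obtain \<N> where \<N>: "countable \<N>" "\<forall>N \<in> \<N>. nowhere_dense_in X N" "A = \<Union>\<N>"
    using assms(1) unfolding meagre_in_def by blast
  \<comment> \<open>\<open>meagre_in\<close> asks for equality with the union, so the pieces are cut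
    down to their traces on \<open>B\<close>.\<close>
  have "\<forall>N \<in> (\<inter>) B ` \<N>. nowhere_dense_in X N"
    using \<N>(2) nowhere_dense_in_subset[OF _ inf_le2] by fastforce
  moreover have "B = \<Union>((\<inter>) B ` \<N>)"
    using \<N>(3) assms(2) by blast
  ultimately show ?thesis
    unfolding meagre_in_def using \<N>(1) by blast
qed

lemma meagre_in_UN:
  assumes "countable I" "\<And>i. i \<in> I \<Longrightarrow> meagre_in X (A i)"
  shows "meagre_in X (\<Union>i\<in>I. A i)"
proof -
  obtain \<N> where \<N>: "\<And>i. i \<in> I \<Longrightarrow>
      countable (\<N> i) \<and> (\<forall>N \<in> \<N> i. nowhere_dense_in X N) \<and> A i = \<Union>(\<N> i)"
    using assms(2) unfolding meagre_in_def by metis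
  show ?thesis
    unfolding meagre_in_def
    by (intro exI[of _ "\<Union>i\<in>I. \<N> i"]) (use \<N> assms(1) in auto)
qed

lemma meagre_in_Un:
  assumes "meagre_in X A" "meagre_in X B"
  shows "meagre_in X (A \<union> B)"
  using meagre_in_UN[of "UNIV :: bool set" X "\<lambda>b. if b then A else B"] assms
  by (auto simp: UNIV_bool Un_commute)

lemma nowhere_dense_in_homeomorphic_image:
  assumes "homeomorphic_map X Y f" "nowhere_dense_in X N"
  shows "nowhere_dense_in Y (f ` N)"
proof -
  have N: "N \<subseteq> topspace X" "X interior_of (X closure_of N) = {}"
    using assms(2) unfolding nowhere_dense_in_def by auto
  have "Y interior_of (Y closure_of (f ` N)) = f ` (X interior_of (X closure_of N))"
    unfolding homeomorphic_map_closure_of[OF assms(1) N(1)]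
    by (rule homeomorphic_map_interior_of[OF assms(1) closure_of_subset_topspace])
  also have "\<dots> = {}"
    using N(2) by simp
  finally show ?thesis
    using image_mono[OF N(1), of f] homeomorphic_imp_surjective_map[OF assms(1)]
    unfolding nowhere_dense_in_def by simp
qed

lemma meagre_in_homeomorphic_image:
  assumes "homeomorphic_map X Y f" "meagre_in X A"
  shows "meagre_in Y (f ` A)"
proof -
  obtain \<N> where \<N>: "countable \<N>" "\<forall>N \<in> \<N>. nowhere_dense_in X N" "A = \<Union>\<N>"
    using assms(2) unfolding meagre_in_def by blast
  show ?thesis
    unfolding meagre_in_def
    using \<N> nowhere_dense_in_homeomorphic_image[OF assms(1)]
    by (intro exI[of _ "(`) f ` \<N>"]) (auto simp: image_Union)
qed

text \<open>Baire category theorem: replacing the nowhere dense pieces by their closures gives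
  countably many closed sets with empty interior, whose union has empty interior yet contains the
  open set \<open>U\<close>.\<close>

lemma meagre_openin_empty:
  assumes "completely_metrizable_space X" "openin X U" "meagre_in X U"
  shows "U = {}"
proof -
  obtain \<N> where \<N>: "countable \<N>" "\<forall>N \<in> \<N>. nowhere_dense_in X N" "U = \<Union>\<N>"
    using assms(3) unfolding meagre_in_def by blast
  have "X interior_of \<Union>((closure_of) X ` \<N>) = {}"
  proof (rule Baire_category_alt)
    fix T assume "T \<in> (closure_of) X ` \<N>"
    then show "closedin X T \<and> X interior_of T = {}"
      using \<N>(2) unfolding nowhere_dense_in_def by auto
  qed (use assms(1) \<N>(1) in simp_all)
  moreover have "U \<subseteq> \<Union>((closure_of) X ` \<N>)"
  proof -
    have "N \<subseteq> X closure_of N" if "N \<in> \<N>" for N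
      using \<N>(2) that closure_of_subset by (metis nowhere_dense_in_def)
    then show ?thesis
      unfolding \<N>(3) by blast
  qed
  ultimately show ?thesis
    using interior_of_maximal[OF _ assms(2)] by blast
qed

section \<open>Set powers and translations\<close>

lemma set_power_mono: "A \<subseteq> B \<Longrightarrow> set_power G A k \<subseteq> set_power G B k"
  by (induction k) (simp_all add: mono_set_mult)

lemma (in group) set_power_subset_carrier:
  "W \<subseteq> carrier G \<Longrightarrow> set_power G W k \<subseteq> carrier G"
  by (induction k) (simp_all add: set_mult_closed)

text \<open>Source of the factor 2 in the exponent: each factor from \<open>W <#> W\<close> splits
  into two factors from \<open>W\<close>.\<close>

lemma (in group) set_power_set_mult_self:
  assumes "W \<subseteq> carrier G"
  shows "set_power G (W <#> W) k = set_power G W (2 * k)"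
  by (induction k) (simp_all add: set_mult_assoc set_power_subset_carrier assms)

text \<open>Exponent 0 is excluded because the zeroth power is \<open>{\<one>}\<close>; the
  induction therefore starts at exponent 1.\<close>

lemma (in group) set_power_carrier:
  assumes "k \<noteq> 0"
  shows "set_power G (carrier G) k = carrier G"
proof -
  have "set_power G (carrier G) (Suc j) = carrier G" for j
    by (induction j) (auto simp: set_mult_carrier_idem[OF subgroup_self] set_mult_def)
  then show ?thesis
    using assms by (metis not0_implies_Suc)
qed

lemma conj_class_subset:
  "conj_invariant G V \<Longrightarrow> v \<in> V \<Longrightarrow> conj_class G v \<subseteq> V"
  unfolding conj_invariant_def conj_class_def by blast

lemma (in group) conj_class_inv:
  assumes "g \<in> carrier G"
  shows "conj_class G (inv g) = set_inv (conj_class G g)"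
proof -
  have "inv (h \<otimes> g \<otimes> inv h) = h \<otimes> inv g \<otimes> inv h" if "h \<in> carrier G" for h
    using assms that by (simp add: inv_mult_group m_assoc)
  then show ?thesis
    unfolding conj_class_def SET_INV_def by force
qed

section \<open>Translations in a topological group\<close>

lemma topological_group_left_translation_continuous:
  assumes "topological_group G X" "g \<in> carrier G"
  shows "continuous_map X X (\<lambda>x. g \<otimes>\<^bsub>G\<^esub> x)"
proof -
  have "continuous_map X (prod_topology X X) (\<lambda>x. (g, x))"
    using assms by (auto simp: continuous_map_pairwise o_def topological_group_def)
  from continuous_map_compose[OF this] show ?thesis
    using assms(1) by (fastforce simp: topological_group_def o_def)
qed

lemma topological_group_left_translation:
  assumes "topological_group G X" "g \<in> carrier G"
  shows "homeomorphic_map X X (\<lambda>x. g \<otimes>\<^bsub>G\<^esub> x)"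
proof -
  interpret group G
    using assms(1) by (simp add: topological_group_def)
  have "homeomorphic_maps X X (\<lambda>x. g \<otimes>\<^bsub>G\<^esub> x) (\<lambda>x. inv\<^bsub>G\<^esub> g \<otimes>\<^bsub>G\<^esub> x)"
    using assms topological_group_left_translation_continuous[OF assms(1)]
    by (auto simp: homeomorphic_maps_def topological_group_def simp flip: m_assoc)
  then show ?thesis
    using homeomorphic_map_maps by blast
qed

lemma topological_group_right_translation_continuous:
  assumes "topological_group G X" "g \<in> carrier G"
  shows "continuous_map X X (\<lambda>x. x \<otimes>\<^bsub>G\<^esub> g)"
proof -
  have "continuous_map X (prod_topology X X) (\<lambda>x. (x, g))"
    using assms by (auto simp: continuous_map_pairwise o_def topological_group_def)
  from continuous_map_compose[OF this] show ?thesis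
    using assms(1) by (fastforce simp: topological_group_def o_def)
qed

text \<open>If \<open>{\<one>}\<close> were open, its left translates would make every singleton
  open and the topology discrete.\<close>

lemma nondiscrete_nbhd_nontrivial:
  assumes "topological_group G X" "X \<noteq> discrete_topology (carrier G)"
    and "openin X V" "\<one>\<^bsub>G\<^esub> \<in> V"
  obtains g where "g \<in> V" "g \<noteq> \<one>\<^bsub>G\<^esub>"
proof -
  interpret group G
    using assms(1) by (simp add: topological_group_def)
  have top: "topspace X = carrier G"
    using assms(1) by (simp add: topological_group_def)
  have "V \<noteq> {\<one>\<^bsub>G\<^esub>}"
  proof
    assume V: "V = {\<one>\<^bsub>G\<^esub>}"
    have "openin X {x}" if x: "x \<in> carrier G" for x
      using homeomorphic_map_openness[OF topological_group_left_translation[OF assms(1) x], of V]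
        assms(3) x by (simp add: V top)
    then have "discrete_topology (carrier G) = X"
      using top by (auto simp: discrete_topology_unique)
    with assms(2) show False by simp
  qed
  then show thesis
    using that assms(4) by blast
qed

section \<open>Bounded normal generation\<close>

text \<open>\<open>W\<close> agrees with an open \<open>U\<close> up to a meagre set. For
  \<open>g\<close> close to \<open>\<one>\<close> the open set formed by \<open>U\<close> and its
  translate by \<open>g\<close> overlaps, and the overlap is too large to be covered by the
  exceptional sets, so \<open>W\<close> meets its own translate by \<open>g\<close>.\<close>

lemma Pettis:
  fixes G (structure)
  assumes tg: "topological_group G X" and cm: "completely_metrizable_space X"
    and BP: "Baire_property_in X W" and nonmeagre: "\<not> meagre_in X W"
  obtains V where "openin X V" "\<one>\<^bsub>G\<^esub> \<in> V" "V \<subseteq> W <#>\<^bsub>G\<^esub> set_inv\<^bsub>G\<^esub> W"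
proof -
  interpret group G
    using tg by (simp add: topological_group_def)
  have top: "topspace X = carrier G"
    using tg by (simp add: topological_group_def)
  obtain U where U: "openin X U" "meagre_in X ((W - U) \<union> (U - W))" and W: "W \<subseteq> carrier G"
    using BP top unfolding Baire_property_in_def by auto
  have mUW: "meagre_in X (U - W)"
    using U(2) by (rule meagre_in_subset) auto
  \<comment> \<open>For empty \<open>U\<close> the symmetric difference is \<open>W\<close>
    itself.\<close>
  have "U \<noteq> {}"
  proof
    assume "U = {}"
    then show False using U(2) nonmeagre by simp
  qed
  then obtain u where u: "u \<in> U" by blast
  have Uc: "U \<subseteq> carrier G"
    using openin_subset[OF U(1)] top by simp
  \<comment> \<open>The preimage of \<open>U\<close> under right translation by \<open>u\<close>:
    for \<open>g\<close> in \<open>V\<close>, the point \<open>g \<otimes> u\<close> witnesses that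
    \<open>U\<close> meets its left translate by \<open>g\<close>.\<close>
  define V where "V = {g \<in> topspace X. g \<otimes>\<^bsub>G\<^esub> u \<in> U}"
  show thesis
  proof
    show "openin X V"
      unfolding V_def
      using openin_continuous_map_preimage
        [OF topological_group_right_translation_continuous[OF tg] U(1)] u Uc by blast
    show "\<one> \<in> V"
      using u Uc by (auto simp: V_def top)
    show "V \<subseteq> W <#> set_inv W"
    proof
      fix g assume "g \<in> V"
      then have g: "g \<in> carrier G" "g \<otimes> u \<in> U"
        by (auto simp: V_def top)
      note hom = topological_group_left_translation[OF tg g(1)]
      let ?gU = "(\<lambda>x. g \<otimes> x) ` U"
      have "openin X ?gU"
        using homeomorphic_map_openness[OF hom] U(1) Uc top by simp
      then have "openin X (U \<inter> ?gU)"
        using U(1) by blast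
      moreover have "U \<inter> ?gU \<noteq> {}"
        using g u by blast
      ultimately have "\<not> meagre_in X (U \<inter> ?gU)"
        using meagre_openin_empty[OF cm] by blast
      moreover have "meagre_in X ((U - W) \<union> (\<lambda>x. g \<otimes> x) ` (U - W))"
        by (intro meagre_in_Un mUW meagre_in_homeomorphic_image[OF hom])
      \<comment> \<open>A point of the overlap outside both exceptional sets lies in
        \<open>W\<close> and has the form \<open>g \<otimes> w\<close> with \<open>w\<close> in
        \<open>W\<close>.\<close>
      ultimately have "\<not> U \<inter> ?gU \<subseteq> (U - W) \<union> (\<lambda>x. g \<otimes> x) ` (U - W)"
        using meagre_in_subset by blast
      then obtain w where w: "w \<in> W" "g \<otimes> w \<in> W"
        by blast
      have "g = (g \<otimes> w) \<otimes> inv w"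
        using g w W by (simp add: m_assoc subsetD)
      then show "g \<in> W <#> set_inv W"
        using w unfolding set_mult_def SET_INV_def by blast
    qed
  qed
qed

section \<open>Large members of a Bergman sequence\<close>

lemma Bergman_sequence_nonmeagre:
  assumes "topological_group G X" "completely_metrizable_space X" "Bergman_sequence G X W"
  obtains n where "\<not> meagre_in X (W n)"
proof -
  interpret group G
    using assms(1) by (simp add: topological_group_def)
  have top: "topspace X = (\<Union>n. W n)" "topspace X = carrier G"
    using assms(1,3) by (auto simp: topological_group_def Bergman_sequence_def)
  \<comment> \<open>The whole space is open and contains the identity, so it is nonmeagre and cannot
    be a countable union of meagre sets.\<close>
  have "\<not> meagre_in X (topspace X)"
    using meagre_openin_empty[OF assms(2) openin_topspace] top(2) one_closed by auto
  then have "\<not> (\<forall>n. meagre_in X (W n))"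
    using meagre_in_UN[of UNIV X W] unfolding top(1) by auto
  then show thesis
    using that by blast
qed

lemma Bergman_sequence_conj_class:
  fixes G (structure)
  assumes "Polish_group G X" "SIN_group G X" "X \<noteq> discrete_topology (carrier G)"
    and "Bergman_sequence G X W"
  obtains n g where "g \<in> carrier G - {\<one>\<^bsub>G\<^esub>}"
    "conj_class G g \<union> conj_class G (inv\<^bsub>G\<^esub> g) \<subseteq> W n <#>\<^bsub>G\<^esub> W n"
proof -
  have tg: "topological_group G X" and cm: "completely_metrizable_space X"
    using assms(1) by (auto simp: Polish_group_def)
  interpret group G
    using tg by (simp add: topological_group_def)
  obtain n where n: "\<not> meagre_in X (W n)"
    using Bergman_sequence_nonmeagre[OF tg cm assms(4)] .
  have W: "W n \<subseteq> carrier G" "set_inv (W n) = W n" "Baire_property_in X (W n)"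
    using assms(4) by (auto simp: Bergman_sequence_def)
  obtain U where U: "openin X U" "\<one> \<in> U" "U \<subseteq> W n <#> W n"
    using Pettis[OF tg cm W(3) n] W(2) by metis
  then obtain V where V: "openin X V" "\<one> \<in> V" "conj_invariant G V" "V \<subseteq> U"
    using assms(2) unfolding SIN_group_def by metis
  obtain g where g: "g \<in> V" "g \<noteq> \<one>"
    using nondiscrete_nbhd_nontrivial[OF tg assms(3) V(1,2)] .
  have gc: "g \<in> carrier G"
    using g(1) openin_subset[OF V(1)] tg by (auto simp: topological_group_def)
  have "conj_class G g \<subseteq> W n <#> W n"
    using conj_class_subset[OF V(3) g(1)] V(4) U(3) by blast
  \<comment> \<open>\<open>V\<close> need not be symmetric, so the class of \<open>inv g\<close>,
    being the inverse of the class of \<open>g\<close>, is reached through the symmetry of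
    \<open>W n\<close>.\<close>
  moreover have "set_inv (W n <#> W n) \<subseteq> W n <#> W n"
  proof -
    have "inv x \<in> W n" if "x \<in> W n" for x
      using W(2) that unfolding SET_INV_def by blast
    moreover have "inv (x \<otimes> y) = inv y \<otimes> inv x" if "x \<in> W n" "y \<in> W n" for x y
      using W(1) that by (auto intro: inv_mult_group)
    ultimately show ?thesis
      unfolding SET_INV_def set_mult_def by auto
  qed
  ultimately have "conj_class G (inv g) \<subseteq> W n <#> W n"
    unfolding conj_class_inv[OF gc] by (auto simp: SET_INV_def)
  with \<open>conj_class G g \<subseteq> W n <#> W n\<close> show thesis
    using that gc g(2) by blast
qed

text \<open>The members form a chain, and a finite set covered by a chain lies in one of its
  members.\<close>

lemma Bergman_sequence_finite:
  assumes "finite (carrier G)" "Bergman_sequence G X W"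
  obtains n where "W n = carrier G"
proof -
  have W: "incseq W" "carrier G = (\<Union>n. W n)"
    using assms(2) by (auto simp: Bergman_sequence_def)
  have chain: "subset.chain UNIV (range W)"
    unfolding subset_chain_def using linear monoD[OF W(1)] by (metis UNIV_I imageE subsetI)
  obtain n where "carrier G \<subseteq> W n"
    using finite_subset_Union_chain[OF assms(1) eq_refl[OF W(2)] _ chain] by blast
  then show thesis
    using that W(2) by blast
qed

text \<open>The dichotomy shared by both claims, established before any generation property enters.
  Finite Polish groups are discrete, so they have no small nontrivial elements and take the first
  alternative.\<close>

lemma Bergman_sequence_exhausted:
  assumes "Polish_group G X" "SIN_group G X"
    and "finite (carrier G) \<or> X \<noteq> discrete_topology (carrier G)"
    and "Bergman_sequence G X W"
  shows "\<exists>n. W n = carrier G \<or> (\<exists>g \<in> carrier G - {\<one>\<^bsub>G\<^esub>}.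
           conj_class G g \<union> conj_class G (inv\<^bsub>G\<^esub> g) \<subseteq> W n <#>\<^bsub>G\<^esub> W n)"
  using assms(3)
proof
  assume "finite (carrier G)"
  then show ?thesis
    using Bergman_sequence_finite assms(4) by metis
next
  assume "X \<noteq> discrete_topology (carrier G)"
  then show ?thesis
    using Bergman_sequence_conj_class[OF assms(1,2) _ assms(4)] by metis
qed

section \<open>Transfer of exponents from conjugacy classes to \<open>W\<close>\<close>

lemma (in group) carrier_eq_set_power_double:
  assumes "W \<subseteq> carrier G" "A \<subseteq> W <#> W" "carrier G = set_power G A k"
  shows "carrier G = set_power G W (2 * k)"
  \<comment> \<open>A squeeze: the \<open>k\<close>-th power of \<open>A\<close>, which is all of
    \<open>G\<close>, lies in that of \<open>W <#> W\<close>, which is the \<open>2 * k\<close>-th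
    power of \<open>W\<close> and lies in \<open>G\<close>.\<close>
  using set_power_mono[OF assms(2), of G k] assms set_power_set_mult_self[OF assms(1)]
    set_power_subset_carrier[OF assms(1)] by blast

text \<open>Handles \<open>W n = carrier G\<close> with the prescribed exponent. For
  \<open>k = 0\<close> a nontrivial element would force the carrier to be \<open>{\<one>}\<close>,
  so the group is trivial.\<close>

lemma (in group) k_BNG_carrier_eq_set_power:
  assumes "k_BNG k G"
  shows "carrier G = set_power G (carrier G) (2 * k)"
proof (cases "k = 0")
  case True
  then have "carrier G = {\<one>}"
    using assms unfolding k_BNG_def by auto
  with True show ?thesis by simp
qed (simp add: set_power_carrier)

theorem proposition2p1:
  fixes G :: "('a, 'b) monoid_scheme" and X :: "'a topology"
  assumes "Polish_group G X" and "SIN_group G X"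
    and "finite (carrier G) \<or> X \<noteq> discrete_topology (carrier G)"
  shows "(BNG G \<longrightarrow> topological_Bergman G X) \<and>
         (\<forall>k. k_BNG k G \<longrightarrow> k_topological_Bergman (2 * k) G X)"
proof -
  interpret group G
    using assms(1) by (simp add: Polish_group_def topological_group_def)
  note exhausted = Bergman_sequence_exhausted[OF assms]
  have sub: "W n \<subseteq> carrier G" if "Bergman_sequence G X W" for W n
    using that unfolding Bergman_sequence_def by blast
  have "\<exists>n k. carrier G = set_power G (W n) k" if "BNG G" and W: "Bergman_sequence G X W" for W
    using exhausted[OF W]
  proof (elim exE disjE bexE)
    fix n assume "W n = carrier G"
    then show ?thesis
      using set_power_carrier[of 1] by (metis one_neq_zero)
  next
    fix n g
    assume "g \<in> carrier G - {\<one>\<^bsub>G\<^esub>}" and "conj_class G g \<union> conj_class G (inv\<^bsub>G\<^esub> g) \<subseteq> W n <#>\<^bsub>G\<^esub> W n"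
    \<comment> \<open>The exponent is twice the one that \<open>BNG\<close> gives for this
      \<open>g\<close>, hence may vary with the sequence.\<close>
    with \<open>BNG G\<close> show ?thesis
      using carrier_eq_set_power_double[OF sub[OF W]] unfolding BNG_def by meson
  qed
  moreover have "\<exists>n. carrier G = set_power G (W n) (2 * k)"
    if "k_BNG k G" and W: "Bergman_sequence G X W" for k W
    using exhausted[OF W]
  proof (elim exE disjE bexE)
    fix n assume "W n = carrier G"
    then show ?thesis
      using k_BNG_carrier_eq_set_power[OF \<open>k_BNG k G\<close>] by metis
  next
    fix n g
    assume "g \<in> carrier G - {\<one>\<^bsub>G\<^esub>}" and "conj_class G g \<union> conj_class G (inv\<^bsub>G\<^esub> g) \<subseteq> W n <#>\<^bsub>G\<^esub> W n"
    \<comment> \<open>Here \<open>g\<close> still varies with the sequence, but the exponent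
      \<open>2 * k\<close> does not.\<close>
    with \<open>k_BNG k G\<close> show ?thesis
      using carrier_eq_set_power_double[OF sub[OF W]] unfolding k_BNG_def by meson
  qed
  ultimately show ?thesis
    unfolding topological_Bergman_def k_topological_Bergman_def by blast
qed

end
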